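(* There is no nonempty open interval $I\subseteq(1/2,1)$ such that $\tau^\flat$ is continuous on $I$, and there is no nonempty open interval $I\subseteq(1/2,1)$ such that $\tau^\sharp$ is continuous on $I$.
   Context: For $\alpha\in(-2,2)$, sequences $\boldsymbol\rho^\flat(\alpha),\boldsymbol\rho^\sharp(\alpha)\in\{-1,+1\}^{\mathbb N_0}$ are defined recursively by $\rho_0^\flat(\alpha)=\rho_0^\sharp(\alpha)=1$ and, for $n\ge1$: $\rho_n^\flat(\alpha)=+1$ if $\sum_{m=0}^{n-1}\alpha^m\rho_m^\flat(\alpha)<0$ and $\rho_n^\flat(\alpha)=-1$ otherwise; $\rho_n^\sharp(\alpha)=+1$ if $\sum_{m=0}^{n-1}\alpha^m\rho_m^\sharp(\alpha)\le0$ and $\rho_n^\sharp(\alpha)=-1$ otherwise. For a $\{-1,+1\}$-valued sequence $\boldsymbol\rho$, $T(\boldsymbol\rho):=\sum_{n=0}^\infty2^{-(n+2)}(1-\rho_n)$. Then $\tau^\flat(\alpha):=T(\boldsymbol\rho^\flat(\alpha))$ and $\tau^\sharp(\alpha):=T(\boldsymbol\rho^\sharp(\alpha))$. (These are the largest and the smallest maximizer in $[0,1/2]$ of the Takagi--Landsberg function $f_\alpha(t)=\sum_{m=0}^\infty\frac{\alpha^m}{2^m}\phi(2^mt)$, $t\in[0,1]$, with $\phi(t)=\min_{z\in\mathbb Z}|t-z|$.) *)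

theory Defs
  imports Complex_Main
begin

fun rho_flat :: "real \<Rightarrow> nat \<Rightarrow> real" where
  "rho_flat \<alpha> n =
     (if n = 0 \<or> (\<Sum>m<n. \<alpha> ^ m * rho_flat \<alpha> m) < 0 then 1 else - 1)"

fun rho_sharp :: "real \<Rightarrow> nat \<Rightarrow> real" where
  "rho_sharp \<alpha> n =
     (if n = 0 \<or> (\<Sum>m<n. \<alpha> ^ m * rho_sharp \<alpha> m) \<le> 0 then 1 else - 1)"

declare rho_flat.simps [simp del] rho_sharp.simps [simp del]

definition T :: "(nat \<Rightarrow> real) \<Rightarrow> real" where
  "T \<rho> = (\<Sum>n. (1 - \<rho> n) / 2 ^ (n + 2))"

(* The parameter is meant to lie in (-2, 2); the formulas below make sense for every real
   parameter, so the functions are left total. *)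
definition tau_flat :: "real \<Rightarrow> real" where
  "tau_flat \<alpha> = T (rho_flat \<alpha>)"

definition tau_sharp :: "real \<Rightarrow> real" where
  "tau_sharp \<alpha> = T (rho_sharp \<alpha>)"

lemma rho_flat_values: "rho_flat \<alpha> n \<in> {- 1, 1}"
  by (subst rho_flat.simps) simp

lemma rho_sharp_values: "rho_sharp \<alpha> n \<in> {- 1, 1}"
  by (subst rho_sharp.simps) simp

lemma summable_T:
  fixes \<rho> :: "nat \<Rightarrow> real"
  assumes "\<And>n. \<rho> n \<in> {- 1, 1}"
  shows "summable (\<lambda>n. (1 - \<rho> n) / 2 ^ (n + 2))"
proof (rule summable_comparison_test')
  show "summable (\<lambda>n. (1 / 2 :: real) ^ n)"
    by (simp add: summable_geometric)
  show "norm ((1 - \<rho> n) / 2 ^ (n + 2)) \<le> (1 / 2) ^ n" if "n \<ge> 0" for n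
    using assms[of n] by (auto simp: power_divide field_simps)
qed

end

theory Submission
  imports Defs "HOL-Complex_Analysis.Complex_Analysis"
begin

text \<open>
  For \<open>1/2 < \<alpha> < 1\<close> the greedy choice of signs forces \<open>\<bar>\<Sum>m<n. \<alpha>^m \<rho>\<^sub>m\<bar> \<le> \<alpha>^(n-1)\<close>, so the series
  \<open>\<Sum>m. \<alpha>^m \<rho>\<^sub>m\<close> vanishes and \<open>\<rho>\<close> cannot be eventually constant.  Hence \<open>\<tau>(\<alpha>) = T(\<rho>)\<close> is never a
  dyadic rational and determines \<open>\<rho>\<close>.  If \<open>\<tau>\<close> were continuous on an interval, it would be constant
  there because the dyadic rationals are dense, and so would be \<open>\<rho>\<close>.  The power series with
  coefficients \<open>\<rho>\<^sub>m\<close> would then vanish on an interval, although its constant term is \<open>1\<close>.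
\<close>

section \<open>Binary expansions given by sign sequences\<close>

text \<open>The numbers \<open>(1 - \<rho> n) / 2\<close> are the binary digits of
  \<open>T \<rho>\<close>. Without constant tails only values with a unique expansion remain, and
  the condition survives shifting and negation.\<close>

definition sign_seq :: "(nat \<Rightarrow> real) \<Rightarrow> bool" where
  "sign_seq \<rho> \<longleftrightarrow> (\<forall>n. \<rho> n \<in> {- 1, 1}) \<and> (\<forall>c. \<not> (\<forall>\<^sub>F n in sequentially. \<rho> n = c))"

lemma sign_seq_values: "sign_seq \<rho> \<Longrightarrow> \<rho> n \<in> {- 1, 1}"
  unfolding sign_seq_def by blast

lemma sign_seq_shift: "sign_seq \<rho> \<Longrightarrow> sign_seq (\<lambda>n. \<rho> (Suc n))"
  unfolding sign_seq_def by (simp add: eventually_sequentially_Suc[of "\<lambda>n. \<rho> n = c" for c])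

lemma sign_seq_uminus:
  assumes "sign_seq \<rho>" shows "sign_seq (\<lambda>n. - \<rho> n)"
  unfolding sign_seq_def
proof (intro conjI allI notI)
  show "- \<rho> n \<in> {- 1, 1}" for n
    using sign_seq_values[OF assms, of n] by auto
  fix c assume "\<forall>\<^sub>F n in sequentially. - \<rho> n = c"
  then have "\<forall>\<^sub>F n in sequentially. \<rho> n = - c"
    by (rule eventually_mono) auto
  then show False
    using assms unfolding sign_seq_def by blast
qed

lemma sign_seq_summable: "sign_seq \<rho> \<Longrightarrow> summable (\<lambda>n. (1 - \<rho> n) / 2 ^ (n + 2))"
  by (rule summable_T) (rule sign_seq_values)

lemma T_pos:
  assumes "sign_seq \<rho>" shows "0 < T \<rho>"
proof -
  have "\<not> (\<forall>n. \<rho> n = 1)"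
  proof
    assume "\<forall>n. \<rho> n = 1"
    then have "\<forall>\<^sub>F n in sequentially. \<rho> n = 1"
      by (rule always_eventually)
    then show False
      using assms unfolding sign_seq_def by blast
  qed
  then obtain i where "\<rho> i \<noteq> 1" by blast
  have "\<rho> i = - 1"
    using sign_seq_values[OF assms, of i] \<open>\<rho> i \<noteq> 1\<close> by blast
  show ?thesis
    unfolding T_def
  proof (rule suminf_pos2[OF sign_seq_summable[OF assms]])
    show "0 \<le> (1 - \<rho> n) / 2 ^ (n + 2)" for n
      using sign_seq_values[OF assms, of n] by auto
    show "0 < (1 - \<rho> i) / 2 ^ (i + 2)"
      using \<open>\<rho> i = - 1\<close> by simp
  qed
qed

text \<open>Negation flips every binary digit; this symmetry turns \<open>T_pos\<close> into the
  upper bound \<open>T_less_1\<close>.\<close>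

lemma T_uminus:
  assumes "sign_seq \<rho>" shows "T (\<lambda>n. - \<rho> n) = 1 - T \<rho>"
proof -
  have "(\<lambda>n. (1 - \<rho> n) / 2 ^ (n + 2) + (1 - - \<rho> n) / 2 ^ (n + 2)) sums (T \<rho> + T (\<lambda>n. - \<rho> n))"
    unfolding T_def
    by (intro sums_add summable_sums sign_seq_summable sign_seq_uminus assms)
  moreover have "(\<lambda>n. (1 - \<rho> n) / 2 ^ (n + 2) + (1 - - \<rho> n) / 2 ^ (n + 2)) = (\<lambda>n. (1/2) ^ Suc n)"
    by (auto simp: fun_eq_iff field_simps)
  ultimately show ?thesis
    using power_half_series sums_unique2 by fastforce
qed

lemma T_less_1: "sign_seq \<rho> \<Longrightarrow> T \<rho> < 1"
  using T_pos[OF sign_seq_uminus] T_uminus by fastforce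

text \<open>Doubling moves the leading binary digit in front of the point. The inductions below use
  this to peel off one digit at a time.\<close>

lemma T_shift:
  assumes "sign_seq \<rho>" shows "2 * T \<rho> = (1 - \<rho> 0) / 2 + T (\<lambda>n. \<rho> (Suc n))"
proof -
  note s = sign_seq_summable[OF assms] sign_seq_summable[OF sign_seq_shift[OF assms]]
  have "T \<rho> = (1 - \<rho> 0) / 4 + (\<Sum>n. (1 - \<rho> (Suc n)) / 2 ^ (Suc n + 2))"
    unfolding T_def using suminf_split_head[OF s(1)] by simp
  also have "(\<Sum>n. (1 - \<rho> (Suc n)) / 2 ^ (Suc n + 2)) = T (\<lambda>n. \<rho> (Suc n)) / 2"
    unfolding T_def using suminf_divide[OF s(2), of 2] by (simp add: field_simps)
  finally show ?thesis by simp
qed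

text \<open>The value of the shifted sequence lies strictly between 0 and 1, so the leading digit
  can be read off from \<open>T \<rho>\<close>.\<close>

lemma floor_double_T:
  assumes "sign_seq \<rho>" shows "of_int \<lfloor>2 * T \<rho>\<rfloor> = (1 - \<rho> 0) / 2"
proof -
  have "\<rho> 0 = - 1 \<or> \<rho> 0 = 1"
    using sign_seq_values[OF assms, of 0] by simp
  then show ?thesis
    using T_shift[OF assms] T_pos[OF sign_seq_shift[OF assms]] T_less_1[OF sign_seq_shift[OF assms]]
    by (auto simp: floor_eq_iff)
qed

lemma T_inject:
  assumes "sign_seq \<rho>" "sign_seq \<sigma>" "T \<rho> = T \<sigma>"
  shows "\<rho> n = \<sigma> n"
  using assms
proof (induction n arbitrary: \<rho> \<sigma>)
  case 0
  then show ?case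
    using floor_double_T[of \<rho>] floor_double_T[of \<sigma>] by simp
next
  case (Suc n)
  have "\<rho> 0 = \<sigma> 0"
    using Suc.prems floor_double_T[of \<rho>] floor_double_T[of \<sigma>] by simp
  then have "T (\<lambda>n. \<rho> (Suc n)) = T (\<lambda>n. \<sigma> (Suc n))"
    using Suc.prems T_shift[of \<rho>] T_shift[of \<sigma>] by simp
  then show ?case
    using Suc.IH[OF sign_seq_shift sign_seq_shift] Suc.prems by blast
qed

text \<open>Each shift of the sequence removes one factor 2 up to an integer, which leads down to
  \<open>N = 0\<close>, where the value lies strictly between 0 and 1.\<close>

lemma T_not_dyadic:
  assumes "sign_seq \<rho>" shows "2 ^ N * T \<rho> \<notin> \<int>"
  using assms
proof (induction N arbitrary: \<rho>)
  case 0
  show ?case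
  proof
    assume "2 ^ 0 * T \<rho> \<in> \<int>"
    then obtain k where "T \<rho> = of_int k" by (auto elim: Ints_cases)
    then show False
      using T_pos[OF 0] T_less_1[OF 0] by simp
  qed
next
  case (Suc N)
  have "\<rho> 0 = - 1 \<or> \<rho> 0 = 1"
    using sign_seq_values[OF Suc.prems, of 0] by simp
  then have int: "2 ^ N * ((1 - \<rho> 0) / 2) \<in> \<int>" by auto
  have "2 ^ N * T (\<lambda>n. \<rho> (Suc n)) = 2 ^ Suc N * T \<rho> - 2 ^ N * ((1 - \<rho> 0) / 2)"
    unfolding power_Suc2 mult.assoc T_shift[OF Suc.prems] by (simp add: algebra_simps)
  then show ?case
    using Suc.IH[OF sign_seq_shift[OF Suc.prems]] int Ints_diff by metis
qed

section \<open>Continuous functions avoiding the dyadic rationals\<close>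

lemma dyadic_between:
  fixes x y :: real
  assumes "x < y"
  obtains z N where "x < z" "z < y" "2 ^ N * z \<in> \<int>"
proof -
  obtain N where "(1/2) ^ N < y - x"
    using real_arch_pow_inv[of "y - x" "1/2"] assms by auto
  then have N: "1 < 2 ^ N * (y - x)"
    by (simp add: power_divide field_simps)
  \<comment> \<open>The least integer strictly above \<open>2 ^ N * x\<close>; it stays below
    \<open>2 ^ N * y\<close> because the scaled gap exceeds 1.\<close>
  define k where "k = \<lfloor>2 ^ N * x\<rfloor> + 1"
  have k: "2 ^ N * x < of_int k" "of_int k \<le> 2 ^ N * x + 1"
    unfolding k_def by linarith+
  show ?thesis
  proof (rule that[of "of_int k / 2 ^ N" N])
    show "x < of_int k / 2 ^ N"
      using k by (simp add: field_simps)
    have "of_int k < 2 ^ N * y"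
      using k N by (simp add: algebra_simps)
    then show "of_int k / 2 ^ N < y"
      by (simp add: field_simps)
  qed auto
qed

lemma continuous_avoiding_dyadic_constant:
  fixes t :: "real \<Rightarrow> real"
  assumes "connected S" "continuous_on S t"
    and "\<And>x N. x \<in> S \<Longrightarrow> 2 ^ N * t x \<notin> \<int>"
    and "x \<in> S" "y \<in> S"
  shows "t x = t y"
proof -
  have no_gap: "\<not> t u < t v" if "u \<in> S" "v \<in> S" for u v
  proof
    assume "t u < t v"
    then obtain z N where z: "t u < z" "z < t v" "2 ^ N * z \<in> \<int>"
      by (rule dyadic_between)
    have "connected (t ` S)"
      using assms(1,2) by (intro connected_continuous_image)
    then have "{t u..t v} \<subseteq> t ` S"
      using that by (intro connected_contains_Icc) auto
    then have "z \<in> t ` S"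
      using z by auto
    then obtain w where "w \<in> S" "z = t w"
      by blast
    then show False
      using assms(3) z by blast
  qed
  show ?thesis
    using no_gap[of x y] no_gap[of y x] assms(4,5) by linarith
qed

section \<open>Series with greedily chosen signs\<close>

text \<open>Each sign opposes the sum S before it, so the new sum has absolute value | |S| -
  \<alpha>^n |. The last hypothesis leaves the sign free when S = 0, which covers both tie-breaking
  rules.\<close>

lemma greedy_partial_sum_bound:
  fixes \<alpha> :: real and \<rho> :: "nat \<Rightarrow> real"
  assumes "1/2 \<le> \<alpha>"
    and "\<And>n. \<rho> n \<in> {- 1, 1}"
    and "\<And>n. \<rho> n * (\<Sum>m<n. \<alpha> ^ m * \<rho> m) \<le> 0"
  shows "\<bar>\<Sum>m<Suc n. \<alpha> ^ m * \<rho> m\<bar> \<le> \<alpha> ^ n"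
proof (induction n)
  case 0
  show ?case using assms(2)[of 0] by auto
next
  case (Suc n)
  \<comment> \<open>The new sum is at most the larger of \<alpha>^(n+1) and \<alpha>^n -
    \<alpha>^(n+1); this inequality makes the first one the larger.\<close>
  have "\<alpha> ^ n \<le> 2 * \<alpha> ^ Suc n"
    using assms(1) mult_right_mono[of 1 "2 * \<alpha>" "\<alpha> ^ n"] by simp
  then show ?case
    using Suc.IH assms(2)[of "Suc n"] assms(3)[of "Suc n"]
    unfolding sum.lessThan_Suc[of _ "Suc n"] by (auto simp del: sum.lessThan_Suc power_Suc)
qed

lemma greedy_sums_0:
  fixes \<alpha> :: real and \<rho> :: "nat \<Rightarrow> real"
  assumes "1/2 \<le> \<alpha>" "\<alpha> < 1"
    and "\<And>n. \<rho> n \<in> {- 1, 1}"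
    and "\<And>n. \<rho> n * (\<Sum>m<n. \<alpha> ^ m * \<rho> m) \<le> 0"
  shows "(\<lambda>m. \<alpha> ^ m * \<rho> m) sums 0"
proof -
  have "(\<lambda>n. \<alpha> ^ n) \<longlonglongrightarrow> 0"
    using assms(1,2) by (intro LIMSEQ_realpow_zero) auto
  moreover have "\<forall>\<^sub>F n in sequentially. norm (\<Sum>m<Suc n. \<alpha> ^ m * \<rho> m) \<le> \<alpha> ^ n"
    unfolding real_norm_def
    by (intro always_eventually allI greedy_partial_sum_bound[OF assms(1,3,4)])
  ultimately have "(\<lambda>n. \<Sum>m<Suc n. \<alpha> ^ m * \<rho> m) \<longlonglongrightarrow> 0"
    by (rule Lim_null_comparison[rotated])
  then show ?thesis
    unfolding sums_def by (rule LIMSEQ_imp_Suc)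
qed

text \<open>A constant tail after index N has absolute value \<alpha>^(N+1) / (1 - \<alpha>), which
  exceeds \<alpha>^N for \<alpha> > 1/2. As the whole series vanishes, the tail is minus a partial
  sum bounded by \<alpha>^N. Strictness matters: at \<alpha> = 1/2 the signs 1, -1, -1, ... are
  greedy.\<close>

lemma greedy_sign_seq:
  fixes \<alpha> :: real and \<rho> :: "nat \<Rightarrow> real"
  assumes "1/2 < \<alpha>" "\<alpha> < 1"
    and "\<And>n. \<rho> n \<in> {- 1, 1}"
    and "\<And>n. \<rho> n * (\<Sum>m<n. \<alpha> ^ m * \<rho> m) \<le> 0"
  shows "sign_seq \<rho>"
  unfolding sign_seq_def
proof (intro conjI allI notI)
  fix c assume "\<forall>\<^sub>F n in sequentially. \<rho> n = c"
  then obtain N where N: "\<And>n. n \<ge> N \<Longrightarrow> \<rho> n = c"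
    by (auto simp: eventually_sequentially)
  have "\<bar>c\<bar> = 1"
    using assms(3)[of N] N[of N] by auto
  let ?S = "\<Sum>m<Suc N. \<alpha> ^ m * \<rho> m"
  have "(\<lambda>m. \<alpha> ^ m * \<rho> m) sums 0"
    using assms by (intro greedy_sums_0) auto
  then have "(\<lambda>m. \<alpha> ^ (m + Suc N) * \<rho> (m + Suc N)) sums (0 - ?S)"
    by (rule sums_split_initial_segment)
  moreover have "(\<lambda>m. (\<alpha> ^ Suc N * c) * \<alpha> ^ m) sums ((\<alpha> ^ Suc N * c) * (1 / (1 - \<alpha>)))"
    using assms(1,2) by (intro sums_mult geometric_sums) auto
  moreover have "(\<lambda>m. \<alpha> ^ (m + Suc N) * \<rho> (m + Suc N)) = (\<lambda>m. (\<alpha> ^ Suc N * c) * \<alpha> ^ m)"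
    using N by (auto simp: fun_eq_iff power_add)
  ultimately have "- ?S = (\<alpha> ^ Suc N * c) * (1 / (1 - \<alpha>))"
    using sums_unique2 by fastforce
  then have "\<bar>?S\<bar> = \<bar>(\<alpha> ^ Suc N * c) * (1 / (1 - \<alpha>))\<bar>"
    by (metis abs_minus_cancel)
  then have "\<bar>?S\<bar> = \<alpha> ^ N * (\<alpha> / (1 - \<alpha>))"
    using assms(1,2) \<open>\<bar>c\<bar> = 1\<close> by (simp add: abs_mult)
  moreover have "\<bar>?S\<bar> \<le> \<alpha> ^ N"
    using assms by (intro greedy_partial_sum_bound) auto
  ultimately have "\<alpha> ^ N * (\<alpha> / (1 - \<alpha>)) \<le> \<alpha> ^ N * 1" by simp
  then have "\<alpha> / (1 - \<alpha>) \<le> 1"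
    using assms(1) by (subst (asm) mult_le_cancel_left_pos) auto
  then show False
    using assms(1,2) by (simp add: field_simps)
qed (rule assms(3))

section \<open>Identity theorem for power series\<close>

text \<open>Bounded coefficients give a holomorphic function on the complex unit disc. Its zeros
  accumulate inside the disc, so it vanishes also at 0, which may lie outside the interval.\<close>

lemma bounded_power_series_zero_on_interval:
  fixes c :: "nat \<Rightarrow> real"
  assumes "\<And>n. \<bar>c n\<bar> \<le> B"
    and "a < b" "{a<..<b} \<subseteq> {-1<..<1}"
    and "\<And>x. x \<in> {a<..<b} \<Longrightarrow> (\<lambda>n. x ^ n * c n) sums 0"
  shows "c 0 = 0"
proof -
  define f where "f z = (\<Sum>n. complex_of_real (c n) * z ^ n)" for z
  have sums: "(\<lambda>n. complex_of_real (c n) * z ^ n) sums f z" if "norm z < 1" for z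
    unfolding f_def
  proof (rule summable_sums, rule summable_comparison_test')
    show "summable (\<lambda>n. B * norm z ^ n)"
      using that by (intro summable_mult summable_geometric) auto
    show "norm (complex_of_real (c n) * z ^ n) \<le> B * norm z ^ n" for n
      using assms(1)[of n] by (simp add: norm_mult norm_power mult_right_mono)
  qed
  have hol: "f holomorphic_on ball 0 1"
    by (rule power_series_holomorphic[where a = "\<lambda>n. complex_of_real (c n)"]) (use sums in auto)
  define U where "U = complex_of_real ` {a<..<b}"
  define p where "p = (a + b) / 2"
  have p: "p \<in> {a<..<b}"
    using assms(2) by (auto simp: p_def)
  have "f 0 = 0"
  proof (rule analytic_continuation[OF hol open_ball connected_ball, of U "of_real p"])
    show "U \<subseteq> ball 0 1"
      using assms(3) by (force simp: U_def)
    show "complex_of_real p \<in> ball 0 1"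
      using assms(3) p by force
    \<comment> \<open>The embedding of the reals is continuous and injective, so it carries limit
      points to limit points.\<close>
    have "p islimpt {a<..<b}"
      using p by (intro interior_limit_point) simp
    then show "complex_of_real p islimpt U"
      unfolding U_def
      by (rule islimpt_isCont_image) (auto simp: eventually_at_filter)
    show "f z = 0" if z: "z \<in> U" for z
    proof -
      obtain x where x: "x \<in> {a<..<b}" "z = of_real x"
        using z by (auto simp: U_def)
      have "(\<lambda>n. complex_of_real (x ^ n * c n)) sums of_real 0"
        using assms(4)[OF x(1)] by (rule sums_of_real)
      then have "(\<lambda>n. complex_of_real (c n) * z ^ n) sums 0"
        by (simp add: x mult.commute)
      moreover have "norm z < 1"
        using x assms(3) by force
      ultimately show ?thesis
        using sums sums_unique2 by blast
    qed
  qed simp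
  moreover have "f 0 = of_real (c 0)"
    unfolding f_def using powser_zero[of "\<lambda>n. complex_of_real (c n)"] by simp
  ultimately show ?thesis by simp
qed

section \<open>Discontinuity on every interval\<close>

lemma greedy_T_not_continuous:
  fixes \<rho> :: "real \<Rightarrow> nat \<Rightarrow> real"
  assumes vals: "\<And>\<alpha> n. \<rho> \<alpha> n \<in> {- 1, 1}"
    and greedy: "\<And>\<alpha> n. \<rho> \<alpha> n * (\<Sum>m<n. \<alpha> ^ m * \<rho> \<alpha> m) \<le> 0"
    and ab: "a < b" "{a<..<b} \<subseteq> {1/2<..<1}"
  shows "\<not> continuous_on {a<..<b} (\<lambda>\<alpha>. T (\<rho> \<alpha>))"
proof
  assume cont: "continuous_on {a<..<b} (\<lambda>\<alpha>. T (\<rho> \<alpha>))"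
  have seq: "sign_seq (\<rho> \<alpha>)" if "\<alpha> \<in> {a<..<b}" for \<alpha>
    using that ab by (intro greedy_sign_seq[of \<alpha>] vals greedy) auto
  define p where "p = (a + b) / 2"
  have p: "p \<in> {a<..<b}"
    using ab by (auto simp: p_def)
  have const: "\<rho> \<alpha> n = \<rho> p n" if \<alpha>: "\<alpha> \<in> {a<..<b}" for \<alpha> n
  proof -
    have "T (\<rho> \<alpha>) = T (\<rho> p)"
    proof (rule continuous_avoiding_dyadic_constant[OF _ cont _ \<alpha> p])
      show "2 ^ N * T (\<rho> x) \<notin> \<int>" if "x \<in> {a<..<b}" for x N
        using T_not_dyadic seq that by blast
    qed simp
    then show ?thesis
      by (rule T_inject[OF seq[OF \<alpha>] seq[OF p]])
  qed
  have "\<rho> p 0 = 0"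
  proof (rule bounded_power_series_zero_on_interval[of "\<rho> p"])
    show "\<bar>\<rho> p n\<bar> \<le> 1" for n
      using vals[of p n] by auto
    show "{a<..<b} \<subseteq> {-1<..<1}"
      using ab(2) by (rule order_trans) auto
    \<comment> \<open>With the signs frozen at \<open>p\<close>, the vanishing series for different
      \<alpha> become values of a single power series.\<close>
    show "(\<lambda>n. \<alpha> ^ n * \<rho> p n) sums 0" if \<alpha>: "\<alpha> \<in> {a<..<b}" for \<alpha>
    proof -
      have "(\<lambda>n. \<alpha> ^ n * \<rho> \<alpha> n) sums 0"
        using \<alpha> ab by (intro greedy_sums_0 vals greedy) auto
      then show ?thesis
        by (simp add: const[OF \<alpha>])
    qed
  qed (rule ab)
  then show False
    using vals[of p 0] by auto
qed

theorem theorem3p9: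
  shows "(\<nexists>a b :: real. a < b \<and> {a<..<b} \<subseteq> {1/2<..<1} \<and> continuous_on {a<..<b} tau_flat) \<and>
         (\<nexists>a b :: real. a < b \<and> {a<..<b} \<subseteq> {1/2<..<1} \<and> continuous_on {a<..<b} tau_sharp)"
proof -
  \<comment> \<open>At a zero sum, including the empty one at \<open>n = 0\<close>, the product is 0
    whichever sign is chosen.\<close>
  have flat: "rho_flat \<alpha> n * (\<Sum>m<n. \<alpha> ^ m * rho_flat \<alpha> m) \<le> 0" for \<alpha> n
  proof (cases "n = 0 \<or> (\<Sum>m<n. \<alpha> ^ m * rho_flat \<alpha> m) < 0")
    case True
    then have "rho_flat \<alpha> n = 1"
      by (subst rho_flat.simps) (rule if_P)
    with True show ?thesis by auto
  next
    case False
    then have "rho_flat \<alpha> n = - 1"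
      by (subst rho_flat.simps) (rule if_not_P)
    with False show ?thesis by auto
  qed
  have sharp: "rho_sharp \<alpha> n * (\<Sum>m<n. \<alpha> ^ m * rho_sharp \<alpha> m) \<le> 0" for \<alpha> n
  proof (cases "n = 0 \<or> (\<Sum>m<n. \<alpha> ^ m * rho_sharp \<alpha> m) \<le> 0")
    case True
    then have "rho_sharp \<alpha> n = 1"
      by (subst rho_sharp.simps) (rule if_P)
    with True show ?thesis by auto
  next
    case False
    then have "rho_sharp \<alpha> n = - 1"
      by (subst rho_sharp.simps) (rule if_not_P)
    with False show ?thesis by auto
  qed
  show ?thesis
    using greedy_T_not_continuous[of rho_flat, OF rho_flat_values flat]
      greedy_T_not_continuous[of rho_sharp, OF rho_sharp_values sharp]
    unfolding tau_flat_def[abs_def] tau_sharp_def[abs_def] by blast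
qed

end
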